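(* Let $(P,\rho,\bar\zeta)$ be an Eulerian quasi-graded poset of rank $n+1$ with $\hat0$ and $\hat1$. Then the symmetric relation $$\bar h_S=\bar h_{\overline S}$$ holds for all subsets $S\subseteq\{1,2,\ldots,n\}$, where $\overline S=\{1,\ldots,n\}\setminus S$.
   Context: A quasi-graded poset $(P,\rho,\bar\zeta)$ consists of a finite poset $P$, a function $\rho:P\to\mathbb N$ with $x<y\Rightarrow\rho(x)<\rho(y)$, and a complex-valued function $\bar\zeta$ in the incidence algebra of $P$ with $\bar\zeta(x,x)=1$ for all $x$. Write $\rho(x,y)=\rho(y)-\rho(x)$. It is Eulerian if for all $x\le z$ $$\sum_{x\le y\le z}(-1)^{\rho(x,y)}\,\bar\zeta(x,y)\,\bar\zeta(y,z)=\delta_{x,z}.$$ If $P$ has a minimal element $\hat0$ and maximal element $\hat1$, normalize $\rho(\hat0)=0$; $P$ has rank $n+1$ ($n\ge0$) if $\rho(\hat1)=n+1$. For $S=\{s_1<\cdots<s_k\}\subseteq\{1,\ldots,n\}$ the flag $\bar f$-vector is $\bar f_S=\sum_{c}\bar\zeta(x_0,x_1)\cdots\bar\zeta(x_k,x_{k+1})$, the sum over all chains $c=\{\hat0=x_0<x_1<\cdots<x_{k+1}=\hat1\}$ with $\rho(x_i)=s_i$ for $1\le i\le k$. The flag $\bar h$-vector is $\bar h_S=\sum_{T\subseteq S}(-1)^{|S\setminus T|}\bar f_T$. *)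

theory Defs
  imports Complex_Main
begin

text \<open>
  The order is a relation with field \<open>P\<close>. The function \<open>\<zeta>\<close> stands for an element of the
  incidence algebra, i.e. a function on the intervals of \<open>P\<close>: only its values at pairs
  \<open>(x, y) \<in> r\<close> are ever used, and its values elsewhere are left unconstrained.
\<close>

locale quasi_graded_poset =
  fixes P :: "'a set" and r :: "'a rel" and \<rho> :: "'a \<Rightarrow> nat" and \<zeta> :: "'a \<Rightarrow> 'a \<Rightarrow> complex"
  assumes finite_carrier: "finite P"
    and partial_order: "partial_order_on P r"
    and rank_strict_mono: "\<And>x y. (x, y) \<in> r \<Longrightarrow> x \<noteq> y \<Longrightarrow> \<rho> x < \<rho> y"
    and zeta_refl: "\<And>x. x \<in> P \<Longrightarrow> \<zeta> x x = 1"

text \<open>In the Eulerian condition \<open>x \<le> y\<close>, so the truncated subtraction \<open>\<rho> y - \<rho> x\<close> is exact.\<close>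

locale eulerian_quasi_graded_poset = quasi_graded_poset +
  assumes eulerian: "\<And>x z. (x, z) \<in> r \<Longrightarrow>
    (\<Sum>y | (x, y) \<in> r \<and> (y, z) \<in> r. (-1) ^ (\<rho> y - \<rho> x) * \<zeta> x y * \<zeta> y z)
      = (if x = z then 1 else 0)"

definition bounded_of_rank :: "'a set \<Rightarrow> 'a rel \<Rightarrow> ('a \<Rightarrow> nat) \<Rightarrow> 'a \<Rightarrow> 'a \<Rightarrow> nat \<Rightarrow> bool" where
  "bounded_of_rank P r \<rho> bt tp m \<longleftrightarrow>
     bt \<in> P \<and> tp \<in> P \<and> (\<forall>x\<in>P. (bt, x) \<in> r \<and> (x, tp) \<in> r) \<and> \<rho> bt = 0 \<and> \<rho> tp = m"

text \<open>
  A chain \<open>x\<^sub>0 < \<dots> < x\<^bsub>k+1\<^esub>\<close> is the list of its elements in increasing order. For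
  \<open>S = {s\<^sub>1 < \<dots> < s\<^sub>k}\<close>, the entry \<open>sorted_list_of_set S ! i\<close> is \<open>s\<^bsub>i+1\<^esub>\<close>.
\<close>

definition flag_chains :: "'a rel \<Rightarrow> ('a \<Rightarrow> nat) \<Rightarrow> 'a \<Rightarrow> 'a \<Rightarrow> nat set \<Rightarrow> 'a list set" where
  "flag_chains r \<rho> bt tp S =
     {xs. length xs = card S + 2 \<and> xs ! 0 = bt \<and> xs ! (card S + 1) = tp \<and>
          (\<forall>i\<le>card S. (xs ! i, xs ! (i + 1)) \<in> r \<and> xs ! i \<noteq> xs ! (i + 1)) \<and>
          (\<forall>i<card S. \<rho> (xs ! (i + 1)) = sorted_list_of_set S ! i)}"

definition flag_f ::
  "'a rel \<Rightarrow> ('a \<Rightarrow> nat) \<Rightarrow> ('a \<Rightarrow> 'a \<Rightarrow> complex) \<Rightarrow> 'a \<Rightarrow> 'a \<Rightarrow> nat set \<Rightarrow> complex" where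
  "flag_f r \<rho> \<zeta> bt tp S =
     (\<Sum>xs\<in>flag_chains r \<rho> bt tp S. \<Prod>i\<le>card S. \<zeta> (xs ! i) (xs ! (i + 1)))"

definition flag_h ::
  "'a rel \<Rightarrow> ('a \<Rightarrow> nat) \<Rightarrow> ('a \<Rightarrow> 'a \<Rightarrow> complex) \<Rightarrow> 'a \<Rightarrow> 'a \<Rightarrow> nat set \<Rightarrow> complex" where
  "flag_h r \<rho> \<zeta> bt tp S = (\<Sum>T\<in>Pow S. (-1) ^ card (S - T) * flag_f r \<rho> \<zeta> bt tp T)"

text \<open>The sum defining \<open>flag_f\<close> is finite, so it is not degenerate.\<close>

lemma (in quasi_graded_poset) finite_flag_chains: "finite (flag_chains r \<rho> bt tp S)"
proof (rule finite_subset)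
  have "r \<subseteq> P \<times> P"
    using partial_order by (simp add: partial_order_on_def preorder_on_def)
  show "flag_chains r \<rho> bt tp S \<subseteq> {xs. set xs \<subseteq> P \<and> length xs = card S + 2}"
  proof clarify
    fix xs assume xs: "xs \<in> flag_chains r \<rho> bt tp S"
    then have len: "length xs = card S + 2"
      and rel: "\<And>i. i \<le> card S \<Longrightarrow> (xs ! i, xs ! (i + 1)) \<in> r"
      by (auto simp: flag_chains_def)
    have "xs ! j \<in> P" if "j < length xs" for j
    proof (cases j)
      case 0
      with rel[of 0] \<open>r \<subseteq> P \<times> P\<close> show ?thesis by auto
    next
      case (Suc i)
      with rel[of i] that len \<open>r \<subseteq> P \<times> P\<close> show ?thesis by auto
    qed
    then show "set xs \<subseteq> P \<and> length xs = card S + 2"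
      using len by (auto simp: in_set_conv_nth)
  qed
  show "finite {xs. set xs \<subseteq> P \<and> length xs = card S + 2}"
    using finite_carrier by (rule finite_lists_length_eq)
qed

end

theory Submission
  imports Defs
begin

text \<open>
  Expanding the inverse of \<open>\<zeta>\<close> over chains (Philip Hall) and comparing with the Eulerian
  relation, which says that this inverse is \<open>(-1)\<^bsup>\<rho>(x,y)\<^esup> \<zeta>(x,y)\<close>, gives
  \[ f_S = \sum_{S \subseteq T \subseteq [n]} (-1)^{n - |T|} f_T . \]
  Substituting this into the definition of \<open>h\<^sub>S\<close>, the coefficient of \<open>f\<^sub>T\<close> contains the
  alternating sum over the subsets of \<open>S \<inter> T\<close>, so only the sets \<open>T\<close> disjoint from \<open>S\<close>
  survive, and what remains is the flag \<open>h\<close>-entry of the complement of \<open>S\<close>.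
\<close>

section \<open>Alternating sums over subsets\<close>

lemma sum_Pow_minus_one_power_card:
  assumes "finite A"
  shows "(\<Sum>T\<in>Pow A. (-1) ^ card T) = (if A = {} then 1 else 0 :: 'b::comm_ring_1)"
  using assms
proof (induction A rule: finite_induct)
  case (insert a A)
  have inj: "inj_on (insert a) (Pow A)"
    using insert.hyps(2) by (auto simp: inj_on_def)
  have card: "card (insert a T) = Suc (card T)" if "T \<in> Pow A" for T
    using that insert.hyps by (auto intro: card_insert_disjoint finite_subset)
  have "(\<Sum>T\<in>Pow (insert a A). (-1) ^ card T :: 'b)
      = (\<Sum>T\<in>Pow A. (-1) ^ card T) + (\<Sum>T\<in>insert a ` Pow A. (-1) ^ card T)"
    unfolding Pow_insert by (rule sum.union_disjoint) (use insert.hyps in auto)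
  also have "(\<Sum>T\<in>insert a ` Pow A. (-1) ^ card T :: 'b) = (\<Sum>T\<in>Pow A. - ((-1) ^ card T))"
    by (simp add: sum.reindex[OF inj] card)
  finally show ?case by (simp add: sum_negf)
qed simp

text \<open>This isolates the passage from flag \<open>f\<close> to flag \<open>h\<close>: the poset
  enters only through the relation assumed for \<open>f\<close>.\<close>

lemma alternating_Pow_sum_complement:
  fixes f :: "'b set \<Rightarrow> 'c::comm_ring_1"
  assumes N: "finite N" and S: "S \<subseteq> N"
    and f: "\<And>T. T \<subseteq> N \<Longrightarrow> f T = (\<Sum>U | T \<subseteq> U \<and> U \<subseteq> N. (-1) ^ card (N - U) * f U)"
  shows "(\<Sum>T\<in>Pow S. (-1) ^ card (S - T) * f T)
    = (\<Sum>T\<in>Pow (N - S). (-1) ^ card (N - S - T) * f T)"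
proof -
  have fS: "finite S" using N S finite_subset by blast
  have sign: "(-1) ^ card (A - T) = ((-1) ^ card A * (-1) ^ card T :: 'c)"
    if "T \<subseteq> A" "finite A" for A T :: "'b set"
  proof -
    have "card A = card (A - T) + card T"
      using that card_Diff_subset[of T A] card_mono[of A T] finite_subset[of T A] by simp
    then show ?thesis by (simp add: power_add mult.assoc flip: power_mult_distrib)
  qed
  have "(\<Sum>T\<in>Pow S. (-1) ^ card (S - T) * f T)
      = (\<Sum>T\<in>Pow S. \<Sum>U | U \<in> Pow N \<and> T \<subseteq> U.
          (-1) ^ card S * (-1) ^ card T * ((-1) ^ card (N - U) * f U))"
  proof (rule sum.cong[OF refl])
    fix T assume T: "T \<in> Pow S"
    have "{U. T \<subseteq> U \<and> U \<subseteq> N} = {U. U \<in> Pow N \<and> T \<subseteq> U}" by auto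
    with T S f[of T] show "(-1) ^ card (S - T) * f T = (\<Sum>U | U \<in> Pow N \<and> T \<subseteq> U.
        (-1) ^ card S * (-1) ^ card T * ((-1) ^ card (N - U) * f U))"
      by (simp add: sign[OF _ fS] sum_distrib_left)
  qed
  also have "\<dots> = (\<Sum>U\<in>Pow N. \<Sum>T | T \<in> Pow S \<and> T \<subseteq> U.
          (-1) ^ card S * (-1) ^ card T * ((-1) ^ card (N - U) * f U))"
    by (rule sum.swap_restrict) (use N fS in auto)
  also have "\<dots> = (\<Sum>U\<in>Pow N. (-1) ^ card S * (-1) ^ card (N - U) * f U *
          (if S \<inter> U = {} then 1 else 0))"
  \<comment> \<open>For fixed \<open>U\<close> the admissible \<open>T\<close> are the subsets of
    \<open>S \<inter> U\<close>, so their signs cancel unless this intersection is empty.\<close>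
  proof (rule sum.cong[OF refl])
    fix U
    have "{T. T \<in> Pow S \<and> T \<subseteq> U} = Pow (S \<inter> U)" by auto
    then show "(\<Sum>T | T \<in> Pow S \<and> T \<subseteq> U.
          (-1) ^ card S * (-1) ^ card T * ((-1) ^ card (N - U) * f U))
      = (-1) ^ card S * (-1) ^ card (N - U) * f U * (if S \<inter> U = {} then 1 else 0)"
      using fS by (simp add: ac_simps sum_distrib_left flip: sum_Pow_minus_one_power_card)
  qed
  also have "\<dots> = (\<Sum>U\<in>Pow (N - S). (-1) ^ card S * (-1) ^ card (N - U) * f U)"
    by (rule sum.mono_neutral_cong_right) (use N in auto)
  also have "\<dots> = (\<Sum>T\<in>Pow (N - S). (-1) ^ card (N - S - T) * f T)"
  proof (rule sum.cong[OF refl])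
    fix U assume U: "U \<in> Pow (N - S)"
    \<comment> \<open>Since \<open>S\<close> lies inside \<open>N - U\<close>, removing it changes
      the sign by exactly \<open>(-1) ^ card S\<close>.\<close>
    have "N - S - U = N - U - S" by auto
    moreover have "S \<subseteq> N - U" using U S by auto
    ultimately show "(-1) ^ card S * (-1) ^ card (N - U) * f U = (-1) ^ card (N - S - U) * f U"
      using sign[of S "N - U"] N by (simp add: ac_simps)
  qed
  finally show ?thesis .
qed

section \<open>Sets of ranks refining a given one\<close>

text \<open>
  The last rank of a chain is determined by \<open>S\<close>, so a refinement may only add ranks below it;
  the empty set has no refinement but itself.
\<close>

definition rank_refinements :: "nat \<Rightarrow> nat set \<Rightarrow> nat set set" where
  "rank_refinements a S = {T. S \<subseteq> T \<and> T \<subseteq> {a<..} \<and> (\<forall>t\<in>T. \<exists>s\<in>S. t \<le> s)}"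

lemma rank_refinements_empty: "rank_refinements a {} = {{}}"
  by (auto simp: rank_refinements_def)

lemma rank_refinements_finite:
  assumes "finite S" "T \<in> rank_refinements a S"
  shows "finite T"
proof (rule finite_subset)
  show "T \<subseteq> (\<Union>s\<in>S. {..s})" using assms(2) by (auto simp: rank_refinements_def)
qed (use assms(1) in auto)

lemma finite_rank_refinements:
  assumes "finite S"
  shows "finite (rank_refinements a S)"
proof (rule finite_subset)
  show "rank_refinements a S \<subseteq> Pow (\<Union>s\<in>S. {..s})" by (auto simp: rank_refinements_def)
qed (use assms in auto)

text \<open>Split off the least element \<open>t\<close> of a refinement. As the refinement contains
  \<open>S\<close>, \<open>t \<le> Min S\<close>; deleting \<open>t\<close> from \<open>S\<close>
  has an effect only when \<open>t = Min S\<close>.\<close>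

lemma rank_refinements_rec:
  assumes S: "finite S" "S \<noteq> {}" "S \<subseteq> {a<..}"
  shows "rank_refinements a S = (\<Union>t\<in>{a<..Min S}. insert t ` rank_refinements t (S - {t}))"
proof (intro equalityI subsetI)
  fix T assume T: "T \<in> rank_refinements a S"
  then have fT: "finite T" and neT: "T \<noteq> {}" and ST: "S \<subseteq> T"
    using rank_refinements_finite S by (auto simp: rank_refinements_def)
  let ?t = "Min T"
  have t: "?t \<in> T" "?t \<le> Min S" "\<And>u. u \<in> T \<Longrightarrow> ?t \<le> u"
    using fT neT ST S by (auto intro: Min_antimono)
  then have "T - {?t} \<in> rank_refinements ?t (S - {?t})"
    unfolding rank_refinements_def mem_Collect_eq
  proof (intro conjI ballI)
    show "S - {?t} \<subseteq> T - {?t}" using ST by blast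
    show "T - {?t} \<subseteq> {?t<..}" using t(3) by (auto simp: order.strict_iff_order)
    fix u assume u: "u \<in> T - {?t}"
    then obtain s where "s \<in> S" "u \<le> s" using T by (auto simp: rank_refinements_def)
    moreover have "?t < u" using u t(3) by (auto simp: order.strict_iff_order)
    ultimately show "\<exists>s\<in>S - {?t}. u \<le> s" by auto
  qed
  moreover have "T = insert ?t (T - {?t})" "?t \<in> {a<..Min S}"
    using t T by (auto simp: rank_refinements_def)
  ultimately show "T \<in> (\<Union>t\<in>{a<..Min S}. insert t ` rank_refinements t (S - {t}))"
    by blast
next
  fix T assume "T \<in> (\<Union>t\<in>{a<..Min S}. insert t ` rank_refinements t (S - {t}))"
  then obtain t U where tU: "t \<in> {a<..Min S}" "U \<in> rank_refinements t (S - {t})" "T = insert t U"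
    by blast
  moreover have "Min S \<in> S" using S by simp
  ultimately have "S \<subseteq> T" "T \<subseteq> {a<..}" "\<forall>u\<in>T. \<exists>s\<in>S. u \<le> s"
    by (auto simp: rank_refinements_def)
  then show "T \<in> rank_refinements a S" by (simp add: rank_refinements_def)
qed

text \<open>The union in \<open>rank_refinements_rec\<close> is disjoint because \<open>t\<close> is
  recovered as the minimum of \<open>insert t U\<close>.\<close>

lemma sum_rank_refinements_rec:
  assumes S: "finite S" "S \<noteq> {}" "S \<subseteq> {a<..}"
  shows "(\<Sum>T\<in>rank_refinements a S. g T)
    = (\<Sum>t\<in>{a<..Min S}. \<Sum>T\<in>rank_refinements t (S - {t}). g (insert t T))"
proof -
  have inj: "inj_on (insert t) (rank_refinements t (S - {t}))" for t
    by (rule inj_onI) (auto simp: rank_refinements_def insert_ident)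
  have Min_ins: "Min (insert t U) = t" if "U \<in> rank_refinements t (S - {t})" for t U
    using that rank_refinements_finite[of "S - {t}" U t] S
    by (intro Min_insert2) (auto simp: rank_refinements_def)
  have disj: "insert t ` rank_refinements t (S - {t}) \<inter> insert u ` rank_refinements u (S - {u}) = {}"
    if "t \<noteq> u" for t u
    using that Min_ins by (metis (no_types, lifting) disjoint_iff imageE)
  show ?thesis
    unfolding rank_refinements_rec[OF S]
    by (subst sum.UNION_disjoint)
       (use S disj in \<open>auto simp: sum.reindex[OF inj] finite_rank_refinements\<close>)
qed

text \<open>With the rank \<open>n + 1\<close> of the top present, the upper bound on a refinement
  is just \<open>n + 1\<close>, so any ranks in \<open>{1..n}\<close> may be added.\<close>

lemma rank_refinements_insert_top:
  assumes "S \<subseteq> {1..n}"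
  shows "rank_refinements 0 (insert (n + 1) S) = insert (n + 1) ` {T. S \<subseteq> T \<and> T \<subseteq> {1..n}}"
proof (intro equalityI subsetI)
  fix T assume T: "T \<in> rank_refinements 0 (insert (n + 1) S)"
  then have "T - {n + 1} \<subseteq> {1..n}"
    using assms by (fastforce simp: rank_refinements_def)
  moreover have "S \<subseteq> T - {n + 1}" "T = insert (n + 1) (T - {n + 1})"
    using T assms by (auto simp: rank_refinements_def)
  ultimately show "T \<in> insert (n + 1) ` {T. S \<subseteq> T \<and> T \<subseteq> {1..n}}" by blast
next
  fix T assume "T \<in> insert (n + 1) ` {T. S \<subseteq> T \<and> T \<subseteq> {1..n}}"
  then show "T \<in> rank_refinements 0 (insert (n + 1) S)"
    by (fastforce simp: rank_refinements_def)
qed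

section \<open>Weighted chain sums by rank\<close>

context quasi_graded_poset
begin

lemma carrier: "r \<subseteq> P \<times> P"
  and r_refl: "x \<in> P \<Longrightarrow> (x, x) \<in> r"
  and r_trans: "(x, y) \<in> r \<Longrightarrow> (y, z) \<in> r \<Longrightarrow> (x, z) \<in> r"
  using partial_order
  by (auto simp: partial_order_on_def preorder_on_def refl_on_def dest: transD)

lemma rank_mono: "(x, y) \<in> r \<Longrightarrow> \<rho> x \<le> \<rho> y"
  using rank_strict_mono by (cases "x = y") (auto intro: less_imp_le)

definition elements_above_at :: "'a \<Rightarrow> nat \<Rightarrow> 'a set" where
  "elements_above_at x s = {y. (x, y) \<in> r \<and> x \<noteq> y \<and> \<rho> y = s}"

lemma finite_elements_above_at: "finite (elements_above_at x s)"
  by (rule finite_subset[OF _ finite_carrier]) (use carrier in \<open>auto simp: elements_above_at_def\<close>)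

text \<open>The recursion exposes the lowest step of a chain, where the Eulerian relation will act.
  Only the rank of the last element is prescribed, not the element.\<close>

primrec chain_sum :: "nat list \<Rightarrow> 'a \<Rightarrow> complex" where
  "chain_sum [] x = 1"
| "chain_sum (s # ss) x = (\<Sum>y\<in>elements_above_at x s. \<zeta> x y * chain_sum ss y)"

text \<open>This bridges \<open>flag_chains\<close>, whose positional indexing it keeps, and
  \<open>chain_sum\<close>, whose recursion it can follow because no top element is fixed.\<close>

definition rank_chains :: "'a \<Rightarrow> nat list \<Rightarrow> 'a list set" where
  "rank_chains x ss = {xs. length xs = length ss + 1 \<and> xs ! 0 = x \<and>
     (\<forall>i<length ss. xs ! (i + 1) \<in> elements_above_at (xs ! i) (ss ! i))}"

lemma rank_chains_Nil: "rank_chains x [] = {[x]}"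
  by (auto simp: rank_chains_def length_Suc_conv)

lemma rank_chains_Cons:
  "rank_chains x (s # ss) = (\<Union>y\<in>elements_above_at x s. (#) x ` rank_chains y ss)"
proof (intro equalityI subsetI)
  fix xs assume xs: "xs \<in> rank_chains x (s # ss)"
  then obtain ys where ys: "xs = x # ys" by (cases xs) (auto simp: rank_chains_def)
  have "ys ! 0 \<in> elements_above_at x s" "ys \<in> rank_chains (ys ! 0) ss"
    using xs ys by (force simp: rank_chains_def)+
  then show "xs \<in> (\<Union>y\<in>elements_above_at x s. (#) x ` rank_chains y ss)" using ys by blast
next
  fix xs assume "xs \<in> (\<Union>y\<in>elements_above_at x s. (#) x ` rank_chains y ss)"
  then show "xs \<in> rank_chains x (s # ss)"
    by (auto simp: rank_chains_def less_Suc_eq_0_disj)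
qed

lemma finite_rank_chains: "finite (rank_chains x ss)"
  by (induction ss arbitrary: x) (auto simp: rank_chains_Nil rank_chains_Cons finite_elements_above_at)

lemma sum_rank_chains:
  "(\<Sum>xs\<in>rank_chains x ss. \<Prod>i<length ss. \<zeta> (xs ! i) (xs ! (i + 1))) = chain_sum ss x"
proof (induction ss arbitrary: x)
  case (Cons s ss)
  let ?w = "\<lambda>ss xs. \<Prod>i<length ss. \<zeta> (xs ! i) (xs ! (i + 1))"
  have hd: "ys ! 0 = y" if "ys \<in> rank_chains y ss" for y ys
    using that by (simp add: rank_chains_def)
  have "(\<Sum>xs\<in>rank_chains x (s # ss). ?w (s # ss) xs)
      = (\<Sum>y\<in>elements_above_at x s. \<Sum>ys\<in>rank_chains y ss. ?w (s # ss) (x # ys))"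
  proof -
    have "(#) x ` rank_chains y ss \<inter> (#) x ` rank_chains z ss = {}" if "y \<noteq> z" for y z
      using hd that by blast
    then show ?thesis
      unfolding rank_chains_Cons
      by (subst sum.UNION_disjoint) (auto simp: finite_elements_above_at finite_rank_chains sum.reindex)
  qed
  \<comment> \<open>The factor at index 0 is \<open>\<zeta> x y\<close>; the others are those of
    \<open>ys\<close>, shifted by one.\<close>
  also have "\<dots> = (\<Sum>y\<in>elements_above_at x s. \<zeta> x y * (\<Sum>ys\<in>rank_chains y ss. ?w ss ys))"
    unfolding sum_distrib_left
    by (intro sum.cong refl)
       (simp add: prod.lessThan_Suc_shift hd del: prod.lessThan_Suc)
  finally show ?case using Cons.IH by simp
qed (simp add: rank_chains_Nil)

definition flag_sum :: "nat set \<Rightarrow> 'a \<Rightarrow> complex" where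
  "flag_sum S = chain_sum (sorted_list_of_set S)"

lemma flag_sum_empty: "flag_sum {} x = 1"
  by (simp add: flag_sum_def)

lemma flag_sum_Min:
  assumes "finite S" "S \<noteq> {}"
  shows "flag_sum S x = (\<Sum>y\<in>elements_above_at x (Min S). \<zeta> x y * flag_sum (S - {Min S}) y)"
  using assms by (simp add: flag_sum_def sorted_list_of_set_nonempty)

lemma flag_sum_insert:
  assumes "finite S" "S \<subseteq> {t<..}"
  shows "flag_sum (insert t S) x = (\<Sum>y\<in>elements_above_at x t. \<zeta> x y * flag_sum S y)"
proof -
  have "Min (insert t S) = t" using assms by (intro Min_insert2) auto
  moreover have "insert t S - {t} = S" using assms(2) by auto
  ultimately show ?thesis using flag_sum_Min[of "insert t S" x] assms(1) by simp
qed

text \<open>All other elements lie strictly below \<open>tp\<close>, so \<open>tp\<close> is the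
  only element of rank \<open>m\<close>. The fixed upper end thus becomes one more rank condition,
  the last one because \<open>m\<close> exceeds all of \<open>S\<close>.\<close>

lemma flag_f_eq_flag_sum:
  assumes b: "bounded_of_rank P r \<rho> bt tp m" and S: "S \<subseteq> {..<m}"
  shows "flag_f r \<rho> \<zeta> bt tp S = flag_sum (insert m S) bt"
proof -
  let ?l = "sorted_list_of_set S"
  have fS: "finite S" using S finite_subset by blast
  have "sorted_list_of_set (insert m S) = ?l @ [m]"
  proof -
    have "sorted (?l @ [m])" "distinct (?l @ [m])"
      using S fS by (auto simp: sorted_append less_imp_le)
    moreover have "insert m S = set (?l @ [m])" using fS by simp
    ultimately show ?thesis
      using sorted_list_of_set.idem_if_sorted_distinct[of "?l @ [m]"] by metis
  qed
  moreover have "flag_chains r \<rho> bt tp S = rank_chains bt (?l @ [m])"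
  proof -
    have top: "x = tp \<longleftrightarrow> \<rho> x = m" if "x \<in> P" for x
      using b that rank_strict_mono[of x tp] less_irrefl by (metis bounded_of_rank_def)
    have "xs \<in> flag_chains r \<rho> bt tp S \<longleftrightarrow> xs \<in> rank_chains bt (?l @ [m])" for xs
    proof -
      have "(xs ! (card S), xs ! (card S + 1)) \<in> r \<Longrightarrow>
          xs ! (card S + 1) = tp \<longleftrightarrow> \<rho> (xs ! (card S + 1)) = m"
        using top carrier by blast
      then show ?thesis
        by (auto simp: flag_chains_def rank_chains_def elements_above_at_def nth_append less_Suc_eq_le
            le_less all_conj_distrib)
    qed
    then show ?thesis by blast
  qed
  moreover have "{..card S} = {..<length (?l @ [m])}" by auto
  ultimately show ?thesis
    using sum_rank_chains[where ss = "?l @ [m]"] by (simp add: flag_f_def flag_sum_def)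
qed

text \<open>Allowing \<open>w = y\<close> merges two cases. If \<open>\<rho> y = Min S\<close>, only
  \<open>w = y\<close> contributes, with \<open>\<zeta> y y = 1\<close>; if \<open>y\<close> is
  lower, this is the usual first step. The Eulerian sum needs both.\<close>

lemma flag_sum_Diff_rank:
  assumes S: "finite S" "S \<noteq> {}" and y: "y \<in> P" "\<rho> y \<le> Min S"
  shows "flag_sum (S - {\<rho> y}) y
    = (\<Sum>w | (y, w) \<in> r \<and> \<rho> w = Min S. \<zeta> y w * flag_sum (S - {Min S}) w)"
proof (cases "\<rho> y = Min S")
  case True
  then have "{w. (y, w) \<in> r \<and> \<rho> w = Min S} = {y}"
    using rank_strict_mono[of y] r_refl[OF y(1)] by force
  then show ?thesis using True y zeta_refl by simp
next
  case False
  then have "\<rho> y \<notin> S" using S(1) y(2) Min_le[of S "\<rho> y"] by linarith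
  then have "S - {\<rho> y} = S" by simp
  moreover have "elements_above_at y (Min S) = {w. (y, w) \<in> r \<and> \<rho> w = Min S}"
    using False by (auto simp: elements_above_at_def)
  ultimately show ?thesis using flag_sum_Min[OF S] by simp
qed

end

section \<open>Consequences of the Eulerian relation\<close>

context eulerian_quasi_graded_poset
begin

text \<open>The full sum vanishes as \<open>x \<noteq> w\<close>, and its term at
  \<open>y = x\<close> is \<open>\<zeta> x w\<close>.\<close>

lemma eulerian_above:
  assumes "(x, w) \<in> r" "x \<noteq> w"
  shows "(\<Sum>y | (x, y) \<in> r \<and> x \<noteq> y \<and> (y, w) \<in> r. (-1) ^ (\<rho> y - \<rho> x) * \<zeta> x y * \<zeta> y w) = - \<zeta> x w"
proof -
  let ?A = "{y. (x, y) \<in> r \<and> (y, w) \<in> r}"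
  have x: "x \<in> P" using assms carrier by auto
  have "finite ?A" by (rule finite_subset[OF _ finite_carrier]) (use carrier in auto)
  moreover have "x \<in> ?A" using assms r_refl[OF x] by auto
  moreover have "?A - {x} = {y. (x, y) \<in> r \<and> x \<noteq> y \<and> (y, w) \<in> r}" by auto
  ultimately show ?thesis
    using eulerian[OF assms(1)] assms(2) zeta_refl[OF x]
    by (simp add: sum.remove[of ?A x] eq_neg_iff_add_eq_0 add.commute)
qed

text \<open>
  The exponent on the right is \<open>Max S - \<rho> x\<close> if \<open>S\<close> is nonempty, and \<open>0\<close> otherwise.
\<close>

lemma sum_rank_refinements_flag_sum:
  assumes "finite S" "S \<subseteq> {\<rho> x<..}" "x \<in> P"
  shows "(\<Sum>T\<in>rank_refinements (\<rho> x) S. (-1) ^ card T * flag_sum T x)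
    = (-1) ^ (Max (insert (\<rho> x) S) - \<rho> x) * flag_sum S x"
  using assms
\<comment> \<open>Detach the first element \<open>y\<close> after \<open>x\<close>, treat the rest
  by induction, and expand one more step from \<open>y\<close> to an element \<open>w\<close> of
  rank \<open>Min S\<close>; the sum over \<open>y\<close> is then Eulerian. The measure drops
  because \<open>y\<close> has larger rank than \<open>x\<close>.\<close>
proof (induction "Max (insert (\<rho> x) S) - \<rho> x" arbitrary: x S rule: less_induct)
  case less
  show ?case
  proof (cases "S = {}")
    case True
    then show ?thesis by (simp add: rank_refinements_empty flag_sum_empty)
  next
    case ne: False
    let ?s = "Min S" and ?M = "Max S"
    let ?Y = "{y. (x, y) \<in> r \<and> x \<noteq> y \<and> \<rho> y \<le> ?s}"
    let ?G = "\<lambda>y S. \<Sum>T\<in>rank_refinements (\<rho> y) S. (-1) ^ card T * flag_sum T y"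
    note fS = less.prems(1)
    have sM: "?s \<le> ?M" using fS ne by simp
    have sx: "\<rho> x < ?s" using fS ne less.prems(2) by (metis Min_in greaterThan_iff subsetD)
    have Mx: "Max (insert (\<rho> x) S) = ?M" using fS ne sM sx by simp
    have fin: "finite {y. (z, y) \<in> r \<and> Q y}" for Q z
      by (rule finite_subset[OF _ finite_carrier]) (use carrier in auto)
    have G: "?G y (S - {\<rho> y}) = (-1) ^ (?M - \<rho> y) * flag_sum (S - {\<rho> y}) y"
      if y: "y \<in> ?Y" for y
    proof -
      \<comment> \<open>Deleting \<open>\<rho> y\<close> may empty \<open>S\<close>; inserting it
        again inside \<open>Max\<close> keeps the highest rank equal to \<open>?M\<close> in every
        case.\<close>
      have "insert (\<rho> y) (S - {\<rho> y}) = insert (\<rho> y) S" by auto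
      moreover have "Max (insert (\<rho> y) S) = ?M" using fS ne sM y by simp
      moreover have "\<rho> x < \<rho> y" using y rank_strict_mono by blast
      moreover have "S - {\<rho> y} \<subseteq> {\<rho> y<..}"
        using y fS ne by (auto simp: order.strict_iff_order)
      ultimately show ?thesis
        using less.hyps[of y "S - {\<rho> y}"] fS Mx y sM carrier by auto
    qed
    have "?G x S = (\<Sum>t\<in>{\<rho> x<..?s}. \<Sum>T\<in>rank_refinements t (S - {t}).
        (-1) ^ card (insert t T) * flag_sum (insert t T) x)"
      using sum_rank_refinements_rec[OF fS ne less.prems(2)] .
    \<comment> \<open>The minus sign accounts for the detached rank \<open>t\<close>.\<close>
    also have "\<dots> = (\<Sum>t\<in>{\<rho> x<..?s}. \<Sum>T\<in>rank_refinements t (S - {t}).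
        \<Sum>y\<in>elements_above_at x t. - (\<zeta> x y * ((-1) ^ card T * flag_sum T y)))"
    proof (intro sum.cong refl)
      fix t T assume T: "T \<in> rank_refinements t (S - {t})"
      have fT: "finite T" using rank_refinements_finite[OF _ T] fS by simp
      have "T \<subseteq> {t<..}" "t \<notin> T" using T by (auto simp: rank_refinements_def)
      with fT show "(-1) ^ card (insert t T) * flag_sum (insert t T) x
          = (\<Sum>y\<in>elements_above_at x t. - (\<zeta> x y * ((-1) ^ card T * flag_sum T y)))"
        by (simp add: flag_sum_insert sum_distrib_left sum_negf ac_simps)
    qed
    also have "\<dots> = (\<Sum>t\<in>{\<rho> x<..?s}. \<Sum>y\<in>elements_above_at x t. - (\<zeta> x y * ?G y (S - {\<rho> y})))"
      by (subst sum.swap) (simp add: elements_above_at_def sum_distrib_left sum_negf)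
    also have "\<dots> = (\<Sum>y\<in>?Y. - (\<zeta> x y * ?G y (S - {\<rho> y})))"
    proof -
      have "?Y = (\<Union>t\<in>{\<rho> x<..?s}. elements_above_at x t)"
        using rank_strict_mono by (auto simp: elements_above_at_def)
      moreover have "elements_above_at x t \<inter> elements_above_at x u = {}" if "t \<noteq> u" for t u
        using that by (auto simp: elements_above_at_def)
      ultimately show ?thesis by (simp add: sum.UNION_disjoint finite_elements_above_at)
    qed
    \<comment> \<open>The range of \<open>w\<close> is described from \<open>x\<close>, with
      \<open>y\<close> tied to it only by \<open>(y, w) \<in> r\<close>, so that the two sums can be
      exchanged next.\<close>
    also have "\<dots> = (\<Sum>y\<in>?Y. \<Sum>w | w \<in> elements_above_at x ?s \<and> (y, w) \<in> r.
        - ((-1) ^ (?M - \<rho> x) * flag_sum (S - {?s}) w * ((-1) ^ (\<rho> y - \<rho> x) * \<zeta> x y * \<zeta> y w)))"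
    proof (rule sum.cong[OF refl])
      fix y assume y: "y \<in> ?Y"
      have "{w. (y, w) \<in> r \<and> \<rho> w = ?s} = {w. w \<in> elements_above_at x ?s \<and> (y, w) \<in> r}"
        using y sx by (auto simp: elements_above_at_def intro: r_trans)
      then have "flag_sum (S - {\<rho> y}) y = (\<Sum>w | w \<in> elements_above_at x ?s \<and> (y, w) \<in> r.
          \<zeta> y w * flag_sum (S - {?s}) w)"
        using flag_sum_Diff_rank[OF fS ne, of y] y carrier by auto
      moreover have "(-1) ^ (?M - \<rho> y) = (-1) ^ (?M - \<rho> x) * ((-1) ^ (\<rho> y - \<rho> x) :: complex)"
      proof -
        have "?M - \<rho> x = (?M - \<rho> y) + (\<rho> y - \<rho> x)" using y sM rank_mono[of x y] by auto
        then show ?thesis by (simp add: power_add mult.assoc flip: power_mult_distrib)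
      qed
      ultimately show "- (\<zeta> x y * ?G y (S - {\<rho> y})) = (\<Sum>w | w \<in> elements_above_at x ?s \<and> (y, w) \<in> r.
        - ((-1) ^ (?M - \<rho> x) * flag_sum (S - {?s}) w * ((-1) ^ (\<rho> y - \<rho> x) * \<zeta> x y * \<zeta> y w)))"
        unfolding G[OF y] by (simp add: sum_distrib_left sum_negf ac_simps)
    qed
    also have "\<dots> = (\<Sum>w\<in>elements_above_at x ?s. \<Sum>y | y \<in> ?Y \<and> (y, w) \<in> r.
        - ((-1) ^ (?M - \<rho> x) * flag_sum (S - {?s}) w * ((-1) ^ (\<rho> y - \<rho> x) * \<zeta> x y * \<zeta> y w)))"
      by (rule sum.swap_restrict) (auto intro: fin finite_elements_above_at)
    \<comment> \<open>For fixed \<open>w\<close> the bound \<open>\<rho> y \<le> ?s\<close> follows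
      from \<open>y \<le> w\<close>. The inner sum is that of \<open>eulerian_above\<close>, whose
      minus sign cancels the one already present.\<close>
    also have "\<dots> = (\<Sum>w\<in>elements_above_at x ?s. (-1) ^ (?M - \<rho> x) * (\<zeta> x w * flag_sum (S - {?s}) w))"
    proof (rule sum.cong[OF refl])
      fix w assume w: "w \<in> elements_above_at x ?s"
      have "{y. y \<in> ?Y \<and> (y, w) \<in> r} = {y. (x, y) \<in> r \<and> x \<noteq> y \<and> (y, w) \<in> r}"
        using w by (auto simp: elements_above_at_def dest: rank_mono)
      then show "(\<Sum>y | y \<in> ?Y \<and> (y, w) \<in> r. - ((-1) ^ (?M - \<rho> x) * flag_sum (S - {?s}) w
            * ((-1) ^ (\<rho> y - \<rho> x) * \<zeta> x y * \<zeta> y w)))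
          = (-1) ^ (?M - \<rho> x) * (\<zeta> x w * flag_sum (S - {?s}) w)"
        using eulerian_above[of x w] w
        by (simp add: elements_above_at_def sum_negf flip: sum_distrib_left)
    qed
    also have "\<dots> = (-1) ^ (?M - \<rho> x) * flag_sum S x"
      by (simp add: flag_sum_Min[OF fS ne] sum_distrib_left)
    finally show ?thesis by (simp add: Mx)
  qed
qed

text \<open>Apply \<open>sum_rank_refinements_flag_sum\<close> at \<open>bt\<close> to
  \<open>insert (n + 1) S\<close>: the exponent becomes \<open>n + 1\<close>, and the extra rank in
  each refinement cancels one sign.\<close>

lemma flag_f_eq_sum_supersets:
  assumes b: "bounded_of_rank P r \<rho> bt tp (n + 1)" and S: "S \<subseteq> {1..n}"
  shows "flag_f r \<rho> \<zeta> bt tp S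
    = (\<Sum>T | S \<subseteq> T \<and> T \<subseteq> {1..n}. (-1) ^ card ({1..n} - T) * flag_f r \<rho> \<zeta> bt tp T)"
proof -
  let ?f = "flag_f r \<rho> \<zeta> bt tp" and ?U = "{T. S \<subseteq> T \<and> T \<subseteq> {1..n}}"
  have fS: "finite S" using S finite_subset by blast
  have bt: "bt \<in> P" "\<rho> bt = 0" using b by (auto simp: bounded_of_rank_def)
  have f: "?f T = flag_sum (insert (n + 1) T) bt" if "T \<subseteq> {1..n}" for T
    using that by (intro flag_f_eq_flag_sum[OF b]) auto
  have inj: "inj_on (insert (n + 1)) ?U"
    by (rule inj_onI) (metis (lifting) atLeastAtMost_iff insert_ident mem_Collect_eq not_less_eq_eq
        order_refl subsetD Suc_eq_plus1)
  have card: "card (insert (n + 1) T) = Suc (card T)" if "T \<subseteq> {1..n}" for T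
    using that finite_subset[OF that] by (subst card_insert_disjoint) auto
  have "Max (insert 0 (insert (n + 1) S)) = n + 1"
    using S fS by (intro Max_eqI) fastforce+
  moreover have "insert (n + 1) S \<subseteq> {\<rho> bt<..}" using S bt by auto
  ultimately have "(\<Sum>T\<in>insert (n + 1) ` ?U. (-1) ^ card T * flag_sum T bt)
      = (-1) ^ (n + 1) * flag_sum (insert (n + 1) S) bt"
    using sum_rank_refinements_flag_sum[of "insert (n + 1) S" bt] fS bt
    by (simp only: rank_refinements_insert_top[OF S] finite_insert diff_zero)
  moreover have "(\<Sum>T\<in>insert (n + 1) ` ?U. (-1) ^ card T * flag_sum T bt)
      = (\<Sum>T\<in>?U. (-1) ^ Suc (card T) * ?f T)"
    unfolding sum.reindex[OF inj] comp_def
    by (rule sum.cong[OF refl]) (metis (lifting) mem_Collect_eq card f)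
  ultimately have "(\<Sum>T\<in>?U. (-1) ^ Suc (card T) * ?f T) = (-1) ^ (n + 1) * ?f S"
    using f[OF S] by simp
  then have eq: "(\<Sum>T\<in>?U. (-1) ^ card T * ?f T) = (-1) ^ n * ?f S"
    by (simp add: sum_negf)
  \<comment> \<open>Passing from \<open>card T\<close> to the size of the complement costs a factor
    \<open>(-1) ^ n\<close>, which cancels the one in \<open>eq\<close>.\<close>
  have "(\<Sum>T\<in>?U. (-1) ^ card ({1..n} - T) * ?f T) = (\<Sum>T\<in>?U. (-1) ^ n * ((-1) ^ card T * ?f T))"
  proof (rule sum.cong[OF refl])
    fix T assume T: "T \<in> ?U"
    then have "n = card ({1..n} - T) + card T"
      using card_Diff_subset[of T "{1..n}"] card_mono[of "{1..n}" T] finite_subset[of T "{1..n}"]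
      by simp
    then have "(-1) ^ n = ((-1) ^ card ({1..n} - T) * (-1) ^ card T :: complex)"
      by (metis power_add)
    then show "(-1) ^ card ({1..n} - T) * ?f T = (-1) ^ n * ((-1) ^ card T * ?f T)"
      by (simp flip: power_mult_distrib)
  qed
  also have "\<dots> = ?f S"
    unfolding sum_distrib_left[symmetric] eq
    by (simp flip: power_mult_distrib mult.assoc)
  finally show ?thesis ..
qed

end

theorem corollary3p8:
  fixes P :: "'a set" and r :: "'a rel" and \<rho> :: "'a \<Rightarrow> nat"
    and \<zeta> :: "'a \<Rightarrow> 'a \<Rightarrow> complex" and bt tp :: 'a and n :: nat and S :: "nat set"
  assumes "eulerian_quasi_graded_poset P r \<rho> \<zeta>"
    and "bounded_of_rank P r \<rho> bt tp (n + 1)"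
    and "S \<subseteq> {1..n}"
  shows "flag_h r \<rho> \<zeta> bt tp S = flag_h r \<rho> \<zeta> bt tp ({1..n} - S)"
  unfolding flag_h_def
  using eulerian_quasi_graded_poset.flag_f_eq_sum_supersets[OF assms(1,2)] assms(3)
  by (intro alternating_Pow_sum_complement) auto

end
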